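(* Let $\{X_t\}$ be a transformed-linear time series in $\mathbb{V}$ such that the matrix $\Gamma_n=[\langle X_i,X_j\rangle]_{i,j=1}^n$ is non-singular for each $n\ge 1$. Then the one-step predictors $\hat X_{n+1}$, $n\ge 0$, and their squared distances of prediction $\nu_n=\|X_{n+1}\ominus \hat X_{n+1}\|^2$ are given by $$\hat X_{n+1}=\begin{cases}0_{\mathbb{V}} & \text{if } n=0,\\ \bigoplus_{j=1}^n\theta_{nj}\circ(X_{n+1-j}\ominus\hat X_{n+1-j}) & \text{if } n\ge 1,\end{cases}$$ where the real numbers $\theta_{nj}$ and $\nu_n$ are computed recursively by $$\nu_0=\langle X_1,X_1\rangle,$$ $$\theta_{n,n-k}=\nu_k^{-1}\Big(\langle X_{n+1},X_{k+1}\rangle-\sum_{j=0}^{k-1}\theta_{k,k-j}\,\theta_{n,n-j}\,\nu_j\Big),\qquad k=0,1,\dots,n-1,$$ $$\nu_n=\langle X_{n+1},X_{n+1}\rangle-\sum_{j=0}^{n-1}\theta_{n,n-j}^2\,\nu_j ,\qquad n\ge 1.$$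
   Context: Transformed-linear arithmetic: $\tau:\mathbb{R}\to\mathbb{R}_+$ is a fixed bijection with $\lim_{y\to\infty}\tau(y)/y=1$ (the standard example is $\tau(y)=\log(1+e^y)$). For nonnegative random variables $X,Y$ and $a\in\mathbb{R}$, $X\oplus Y=\tau(\tau^{-1}(X)+\tau^{-1}(Y))$, $a\circ X=\tau(a\,\tau^{-1}(X))$, and $X\ominus Y=X\oplus((-1)\circ Y)$. Infinite combinations are $\bigoplus_j a_j\circ X_j=\tau(\sum_j a_j\tau^{-1}(X_j))$. Noise: $\{Z_j\}_{j\ge 0}$ are independent nonnegative random variables, regularly varying with tail index $2$ and tail stationary, with $\lim_{x\to\infty}\mathrm{Pr}(Z_j>x)/\{x^{-2}L(x)\}=1$ for every $j$, for a common slowly varying function $L$; they meet the lower-tail condition associated with $\tau$ (for $\tau(y)=\log(1+e^y)$: $s\,\mathrm{Pr}[Z_j\le \exp\{-k\,b(s)\}]\to 0$ as $s\to\infty$ for every $k>0$, where $b(s)$ is the normalizing function of regular variation). Space $\mathbb{V}$: the set of all $X=\bigoplus_{j=0}^\infty\psi_j\circ Z_j$ with $\psi_j\in\mathbb{R}$, $\sum_j|\psi_j|<\infty$ (such series converge with probability one); it is a vector space under $\oplus,\circ$, with zero element $0_{\mathbb{V}}=\tau(0)$. A transformed-linear time series in $\mathbb{V}$ is a sequence $X_t=\bigoplus_{j=0}^\infty\psi_{t,j}\circ Z_j\in\mathbb{V}$. The inner product is $\langle X_t,X_s\rangle=\sum_{j=0}^\infty\psi_{t,j}\psi_{s,j}$,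 and $\|X\|=\sqrt{\langle X,X\rangle}$. One-step predictors: for $n\ge1$ let $\mathbb{V}^n=\{\bigoplus_{j=1}^n b_j\circ X_{n+1-j}: b_1,\dots,b_n\in\mathbb{R}\}$; $\hat X_{n+1}=P_{\mathbb{V}^n}X_{n+1}$ is the orthogonal projection of $X_{n+1}$ on $\mathbb{V}^n$, i.e. the element of $\mathbb{V}^n$ with $\langle X_{n+1}\ominus\hat X_{n+1},X_{n+1-k}\rangle=0$ for $k=1,\dots,n$; and $\hat X_1=0_{\mathbb{V}}$. *)

theory Defs
  imports "HOL-Probability.Probability" "Jordan_Normal_Form.Matrix"
begin

section \<open>Regular variation\<close>

definition slowly_varying :: "(real \<Rightarrow> real) \<Rightarrow> bool" where
  "slowly_varying L \<longleftrightarrow>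
     L \<in> borel_measurable borel \<and> (\<forall>\<^sub>F x in at_top. L x > 0) \<and>
     (\<forall>a>0. ((\<lambda>x. L (a * x) / L x) \<longlongrightarrow> 1) at_top)"

text \<open>Regular variation of a nonnegative random variable with tail index \<open>\<alpha>\<close> and normalizing
  function \<open>b\<close>. The limit measure of \<open>(x, \<infinity>)\<close> is \<open>c x\<^sup>-\<^sup>\<alpha>\<close>; since \<open>b\<close> is determined only up to
  asymptotic equivalence and a positive factor, the scale \<open>c\<close> is left free.\<close>

definition regularly_varying_rv :: "'a measure \<Rightarrow> real \<Rightarrow> (real \<Rightarrow> real) \<Rightarrow> ('a \<Rightarrow> real) \<Rightarrow> bool" where
  "regularly_varying_rv M \<alpha> b Y \<longleftrightarrow>
     filterlim b at_top at_top \<and>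
     (\<exists>c>0. \<forall>x>0. ((\<lambda>s. s * measure M {\<omega> \<in> space M. Y \<omega> > b s * x})
                       \<longlongrightarrow> c * x powr (- \<alpha>)) at_top)"

text \<open>Tail stationarity: for every \<open>h\<close>, the limit measure of
  \<open>s Pr((Z\<^sub>t, \<dots>, Z\<^sub>t\<^sub>+\<^sub>h) / b(s) \<in> \<cdot>)\<close> does not depend on \<open>t\<close>. Convergence is
  tested on the complements of the rectangles \<open>[0, x]\<close>, which determine vague convergence on
  \<open>[0, \<infinity>]\<^sup>h\<^sup>+\<^sup>1\<close> without the origin.\<close>

definition tail_stationary :: "'a measure \<Rightarrow> (real \<Rightarrow> real) \<Rightarrow> (nat \<Rightarrow> 'a \<Rightarrow> real) \<Rightarrow> bool" where
  "tail_stationary M b Z \<longleftrightarrow>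
     (\<forall>h x. (\<forall>i\<le>h. 0 < x i) \<longrightarrow>
        (\<exists>c. \<forall>t. ((\<lambda>s. s * measure M {\<omega> \<in> space M. \<exists>i\<le>h. Z (t + i) \<omega> > b s * x i})
                      \<longlongrightarrow> c) at_top))"

text \<open>For increasing \<open>\<tau>\<close> with range \<open>(0, \<infinity>)\<close> the event below is \<open>Y \<le> \<tau>(- k b(s))\<close>. For
  \<open>\<tau>(y) = log(1 + exp y)\<close> we have \<open>exp(y) / 2 \<le> \<tau>(y) \<le> exp(y)\<close> for \<open>y \<le> 0\<close>, so, \<open>k > 0\<close> being
  arbitrary and \<open>b(s) \<rightarrow> \<infinity>\<close>, the condition is \<open>s Pr[Y \<le> exp(- k b(s))] \<rightarrow> 0\<close> for every \<open>k > 0\<close>.\<close>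

definition lower_tail_condition ::
    "'a measure \<Rightarrow> (real \<Rightarrow> real) \<Rightarrow> (real \<Rightarrow> real) \<Rightarrow> ('a \<Rightarrow> real) \<Rightarrow> bool" where
  "lower_tail_condition M \<tau> b Y \<longleftrightarrow>
     (\<forall>k>0. ((\<lambda>s. s * measure M {\<omega> \<in> space M. Y \<omega> \<notin> \<tau> ` {- k * b s <..}}) \<longlongrightarrow> 0) at_top)"

section \<open>Transformation and noise\<close>

text \<open>Outside the range of \<open>\<tau>\<close> the total function \<open>inv_into UNIV \<tau>\<close> is constant. Measurability of \<open>\<tau>\<close>
  and of its inverse is what makes the operations below send random variables to random
  variables.\<close>

locale transformed_linear_noise = prob_space M
  for M :: "'a measure" +
  fixes \<tau> :: "real \<Rightarrow> real" and Z :: "nat \<Rightarrow> 'a \<Rightarrow> real"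
    and L :: "real \<Rightarrow> real" and b :: "real \<Rightarrow> real"
  assumes tau_bij: "bij_betw \<tau> UNIV {0<..}"
    and tau_measurable: "\<tau> \<in> borel_measurable borel"
    and tau_inv_measurable: "inv_into UNIV \<tau> \<in> borel_measurable borel"
    and tau_asymp: "((\<lambda>y. \<tau> y / y) \<longlongrightarrow> 1) at_top"
    and Z_indep: "indep_vars (\<lambda>_. borel) Z UNIV"
    and Z_nonneg: "\<And>j \<omega>. \<omega> \<in> space M \<Longrightarrow> 0 \<le> Z j \<omega>"
    and L_slowly_varying: "slowly_varying L"
    and Z_regularly_varying: "\<And>j. regularly_varying_rv M 2 b (Z j)"
    and Z_tail_stationary: "tail_stationary M b Z"
    and Z_tail: "\<And>j. ((\<lambda>x. prob {\<omega> \<in> space M. Z j \<omega> > x} / (x powr (-2) * L x)) \<longlongrightarrow> 1) at_top"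
    and Z_lower_tail: "\<And>j. lower_tail_condition M \<tau> b (Z j)"

section \<open>Transformed-linear arithmetic\<close>

definition tl_add :: "(real \<Rightarrow> real) \<Rightarrow> ('a \<Rightarrow> real) \<Rightarrow> ('a \<Rightarrow> real) \<Rightarrow> 'a \<Rightarrow> real" where
  "tl_add \<tau> X Y = (\<lambda>\<omega>. \<tau> (inv_into UNIV \<tau> (X \<omega>) + inv_into UNIV \<tau> (Y \<omega>)))"

definition tl_scale :: "(real \<Rightarrow> real) \<Rightarrow> real \<Rightarrow> ('a \<Rightarrow> real) \<Rightarrow> 'a \<Rightarrow> real" where
  "tl_scale \<tau> a X = (\<lambda>\<omega>. \<tau> (a * inv_into UNIV \<tau> (X \<omega>)))"

definition tl_diff :: "(real \<Rightarrow> real) \<Rightarrow> ('a \<Rightarrow> real) \<Rightarrow> ('a \<Rightarrow> real) \<Rightarrow> 'a \<Rightarrow> real" where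
  "tl_diff \<tau> X Y = tl_add \<tau> X (tl_scale \<tau> (-1) Y)"

definition tl_zero :: "(real \<Rightarrow> real) \<Rightarrow> 'a \<Rightarrow> real" where
  "tl_zero \<tau> = (\<lambda>\<omega>. \<tau> 0)"

definition tl_sum :: "(real \<Rightarrow> real) \<Rightarrow> ('i \<Rightarrow> 'a \<Rightarrow> real) \<Rightarrow> 'i set \<Rightarrow> 'a \<Rightarrow> real" where
  "tl_sum \<tau> Y I = (\<lambda>\<omega>. \<tau> (\<Sum>i\<in>I. inv_into UNIV \<tau> (Y i \<omega>)))"

section \<open>The space of transformed-linear combinations of the noise\<close>

text \<open>\<open>X = \<Oplus>\<^sub>j \<psi>\<^sub>j \<circ> Z\<^sub>j\<close> as random variables, i.e. almost surely. Almost sure convergence of the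
  series is part of the predicate, so no uniformity in \<open>j\<close> of the tails has to be assumed.\<close>

definition has_tl_coeffs ::
    "'a measure \<Rightarrow> (real \<Rightarrow> real) \<Rightarrow> (nat \<Rightarrow> 'a \<Rightarrow> real) \<Rightarrow> ('a \<Rightarrow> real) \<Rightarrow> (nat \<Rightarrow> real) \<Rightarrow> bool" where
  "has_tl_coeffs M \<tau> Z X \<psi> \<longleftrightarrow>
     X \<in> borel_measurable M \<and> summable (\<lambda>j. \<bar>\<psi> j\<bar>) \<and>
     (AE \<omega> in M. summable (\<lambda>j. \<psi> j * inv_into UNIV \<tau> (Z j \<omega>)) \<and>
                 X \<omega> = \<tau> (\<Sum>j. \<psi> j * inv_into UNIV \<tau> (Z j \<omega>)))"

definition tl_space ::
    "'a measure \<Rightarrow> (real \<Rightarrow> real) \<Rightarrow> (nat \<Rightarrow> 'a \<Rightarrow> real) \<Rightarrow> ('a \<Rightarrow> real) set" where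
  "tl_space M \<tau> Z = {X. \<exists>\<psi>. has_tl_coeffs M \<tau> Z X \<psi>}"

text \<open>For noise as above the coefficients of an element of the space are unique: if
  \<open>\<Sum>\<^sub>j d\<^sub>j \<tau>\<^sup>-\<^sup>1(Z\<^sub>j) = 0\<close> almost surely with \<open>d\<^sub>k \<noteq> 0\<close>, then \<open>\<tau>\<^sup>-\<^sup>1(Z\<^sub>k)\<close> is independent of
  itself, hence almost surely constant, contradicting the tail of \<open>Z\<^sub>k\<close>.\<close>

definition tl_coeffs ::
    "'a measure \<Rightarrow> (real \<Rightarrow> real) \<Rightarrow> (nat \<Rightarrow> 'a \<Rightarrow> real) \<Rightarrow> ('a \<Rightarrow> real) \<Rightarrow> nat \<Rightarrow> real" where
  "tl_coeffs M \<tau> Z X = (THE \<psi>. has_tl_coeffs M \<tau> Z X \<psi>)"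

definition tl_inner ::
    "'a measure \<Rightarrow> (real \<Rightarrow> real) \<Rightarrow> (nat \<Rightarrow> 'a \<Rightarrow> real) \<Rightarrow> ('a \<Rightarrow> real) \<Rightarrow> ('a \<Rightarrow> real) \<Rightarrow> real" where
  "tl_inner M \<tau> Z X Y = (\<Sum>j. tl_coeffs M \<tau> Z X j * tl_coeffs M \<tau> Z Y j)"

definition tl_norm ::
    "'a measure \<Rightarrow> (real \<Rightarrow> real) \<Rightarrow> (nat \<Rightarrow> 'a \<Rightarrow> real) \<Rightarrow> ('a \<Rightarrow> real) \<Rightarrow> real" where
  "tl_norm M \<tau> Z X = sqrt (tl_inner M \<tau> Z X X)"

definition gram_matrix ::
    "'a measure \<Rightarrow> (real \<Rightarrow> real) \<Rightarrow> (nat \<Rightarrow> 'a \<Rightarrow> real) \<Rightarrow> (nat \<Rightarrow> 'a \<Rightarrow> real) \<Rightarrow> nat \<Rightarrow> real mat" where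
  "gram_matrix M \<tau> Z X n = Matrix.mat n n (\<lambda>(i, j). tl_inner M \<tau> Z (X (i + 1)) (X (j + 1)))"

section \<open>One-step predictors\<close>

definition past_span :: "(real \<Rightarrow> real) \<Rightarrow> (nat \<Rightarrow> 'a \<Rightarrow> real) \<Rightarrow> nat \<Rightarrow> ('a \<Rightarrow> real) set" where
  "past_span \<tau> X n =
     {Y. \<exists>\<beta>. Y = tl_sum \<tau> (\<lambda>j. tl_scale \<tau> (\<beta> j) (X (n + 1 - j))) {1..n}}"

text \<open>\<open>one_step_predictor M \<tau> Z X t\<close> is the prediction of \<open>X t\<close> from \<open>X 1, \<dots>, X (t - 1)\<close>, for
  \<open>t \<ge> 1\<close>. When the Gram matrix of \<open>X 1, \<dots>, X (t - 1)\<close> is non-singular, the definite description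
  denotes, even with pointwise equality of random variables.\<close>

definition one_step_predictor ::
    "'a measure \<Rightarrow> (real \<Rightarrow> real) \<Rightarrow> (nat \<Rightarrow> 'a \<Rightarrow> real) \<Rightarrow> (nat \<Rightarrow> 'a \<Rightarrow> real) \<Rightarrow> nat \<Rightarrow> 'a \<Rightarrow> real" where
  "one_step_predictor M \<tau> Z X t =
     (if t \<le> 1 then tl_zero \<tau>
      else (THE Y. Y \<in> past_span \<tau> X (t - 1) \<and>
              (\<forall>k\<in>{1..t - 1}. tl_inner M \<tau> Z (tl_diff \<tau> (X t) Y) (X (t - k)) = 0)))"

section \<open>The innovations recursion\<close>

text \<open>\<open>G i j\<close> stands for \<open>\<langle>X\<^sub>i, X\<^sub>j\<rangle>\<close> with \<open>i, j \<ge> 1\<close>. The equation for \<open>innov_theta G n j\<close> is the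
  recursion for \<open>\<theta>\<^sub>n\<^sub>,\<^sub>n\<^sub>-\<^sub>k\<close> with \<open>k = n - j\<close>; the lemmas below restate it in terms of \<open>k\<close>.\<close>

function innov_theta :: "(nat \<Rightarrow> nat \<Rightarrow> real) \<Rightarrow> nat \<Rightarrow> nat \<Rightarrow> real"
  and innov_nu :: "(nat \<Rightarrow> nat \<Rightarrow> real) \<Rightarrow> nat \<Rightarrow> real" where
  "innov_theta G n j =
     (if 1 \<le> j \<and> j \<le> n then
        inverse (innov_nu G (n - j)) *
        (G (n + 1) (n - j + 1) -
         (\<Sum>i<n - j. innov_theta G (n - j) (n - j - i) * innov_theta G n (n - i) * innov_nu G i))
      else 0)"
| "innov_nu G n = G (n + 1) (n + 1) - (\<Sum>i<n. (innov_theta G n (n - i))\<^sup>2 * innov_nu G i)"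
  by pat_completeness auto
termination
  by (relation "measures
        [\<lambda>x. case x of Inl (G, n, j) \<Rightarrow> n | Inr (G, n) \<Rightarrow> n,
         \<lambda>x. case x of Inl (G, n, j) \<Rightarrow> n - j | Inr (G, n) \<Rightarrow> n]") auto

declare innov_theta.simps [simp del] innov_nu.simps [simp del]

lemma innov_nu_0: "innov_nu G 0 = G 1 1"
  by (subst innov_nu.simps) simp

lemma innov_theta_rec:
  assumes "k < n"
  shows "innov_theta G n (n - k) =
           inverse (innov_nu G k) *
           (G (n + 1) (k + 1) -
            (\<Sum>j<k. innov_theta G k (k - j) * innov_theta G n (n - j) * innov_nu G j))"
  proof -
  have "1 \<le> n - k \<and> n - k \<le> n" and "n - (n - k) = k"
    using assms by auto
  then show ?thesis
    by (simp only: innov_theta.simps[of G n "n - k"] simp_thms if_True)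
qed

lemma innov_nu_rec:
  "innov_nu G n = G (n + 1) (n + 1) - (\<Sum>j<n. (innov_theta G n (n - j))\<^sup>2 * innov_nu G j)"
  by (rule innov_nu.simps)

end

theory Submission
  imports Defs
begin

text \<open>The innovations recursion is Gram--Schmidt. Put \<open>e\<^sub>m = X\<^sub>m\<^sub>+\<^sub>1 \<ominus> \<Oplus>\<^sub>k\<^sub><\<^sub>m \<theta>\<^sub>m\<^sub>,\<^sub>m\<^sub>-\<^sub>k \<circ> e\<^sub>k\<close>. The formula
  for \<open>\<theta>\<^sub>m\<^sub>,\<^sub>m\<^sub>-\<^sub>k\<close> says exactly that \<open>\<langle>X\<^sub>m\<^sub>+\<^sub>1, e\<^sub>k\<rangle> = \<theta>\<^sub>m\<^sub>,\<^sub>m\<^sub>-\<^sub>k \<nu>\<^sub>k\<close>, provided that the earlier \<open>\<nu>\<close> do not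
  vanish and the earlier \<open>e\<close> are orthogonal with squared norms \<open>\<nu>\<close>; then \<open>e\<^sub>m\<close> is orthogonal to
  \<open>e\<^sub>0, \<dots>, e\<^sub>m\<^sub>-\<^sub>1\<close> and has squared norm \<open>\<nu>\<^sub>m\<close>. If \<open>\<nu>\<^sub>m\<close> were zero, \<open>e\<^sub>m\<close> would be orthogonal to all of
  \<open>X\<^sub>1, \<dots>, X\<^sub>m\<^sub>+\<^sub>1\<close>; as its coefficient at \<open>X\<^sub>m\<^sub>+\<^sub>1\<close> is 1, the Gram matrix would be singular. This is
  \<open>innov_coeff_orthogonal_system\<close>, and since it only involves the numbers \<open>\<langle>X\<^sub>i, X\<^sub>j\<rangle>\<close>, it is carried
  out for formal linear combinations, given by their coefficients, with an arbitrary symmetric Gram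
  matrix. Orthogonality of \<open>e\<^sub>m\<close> to the past makes \<open>\<Oplus>\<^sub>k\<^sub><\<^sub>m \<theta>\<^sub>m\<^sub>,\<^sub>m\<^sub>-\<^sub>k \<circ> e\<^sub>k\<close> a solution of the normal
  equations, and non-singularity makes it the only one, so it is the predictor
  (\<open>one_step_predictor_eq_innov_predictor\<close>).

  The inner product can be computed from the formal combinations as soon as it is bilinear, for which
  the coefficients of an element of the space must be unique
  (\<open>has_tl_coeffs_unique\<close>). If they were not, some \<open>\<tau>\<^sup>-\<^sup>1(Z\<^sub>k)\<close> would almost surely be a function of
  the other noise variables and hence independent of itself. Then the probabilities
  \<open>Pr(Z\<^sub>k > b(s))\<close> would be 0 or 1 for large \<open>s\<close>, whereas regular variation makes
  \<open>s Pr(Z\<^sub>k > b(s))\<close> converge to a positive number.\<close>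

section \<open>Innovations of a symmetric Gram matrix\<close>

text \<open>The inner product of \<open>\<Sum>\<^sub>i c\<^sub>i X\<^sub>i\<close> and \<open>\<Sum>\<^sub>j d\<^sub>j X\<^sub>j\<close> when
  \<open>\<langle>X\<^sub>i, X\<^sub>j\<rangle> = G i j\<close>, the indices running from 1 to \<open>N\<close>. The unit sequence at \<open>s\<close> represents \<open>X\<^sub>s\<close>.\<close>
definition gram_form :: "(nat \<Rightarrow> nat \<Rightarrow> real) \<Rightarrow> nat \<Rightarrow> (nat \<Rightarrow> real) \<Rightarrow> (nat \<Rightarrow> real) \<Rightarrow> real" where
  "gram_form G N c d = (\<Sum>i=1..N. \<Sum>j=1..N. c i * d j * G i j)"

text \<open>The coefficients, with respect to \<open>X\<^sub>1, X\<^sub>2, \<dots>\<close>, of the innovation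
  \<open>e\<^sub>m = X\<^sub>m\<^sub>+\<^sub>1 - \<Sum>\<^sub>k\<^sub><\<^sub>m \<theta>\<^sub>m\<^sub>,\<^sub>m\<^sub>-\<^sub>k e\<^sub>k\<close>.\<close>

fun innov_coeff :: "(nat \<Rightarrow> nat \<Rightarrow> real) \<Rightarrow> nat \<Rightarrow> nat \<Rightarrow> real" where
  "innov_coeff G m i =
     of_bool (i = m + 1) - (\<Sum>k<m. innov_theta G m (m - k) * innov_coeff G k i)"

declare innov_coeff.simps [simp del]

definition innov_predictor_coeff :: "(nat \<Rightarrow> nat \<Rightarrow> real) \<Rightarrow> nat \<Rightarrow> nat \<Rightarrow> real" where
  "innov_predictor_coeff G m i = (\<Sum>k<m. innov_theta G m (m - k) * innov_coeff G k i)"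

lemma gram_form_commute:
  assumes "\<And>i j. G i j = G j i"
  shows "gram_form G N c d = gram_form G N d c"
  unfolding gram_form_def
  by (subst sum.swap) (simp add: assms mult.commute)

lemma gram_form_add_left:
  "gram_form G N (\<lambda>i. c i + d i) e = gram_form G N c e + gram_form G N d e"
  by (simp add: gram_form_def algebra_simps sum.distrib)

lemma gram_form_diff_left:
  "gram_form G N (\<lambda>i. c i - d i) e = gram_form G N c e - gram_form G N d e"
  by (simp add: gram_form_def algebra_simps sum_subtractf)

lemma gram_form_sum_left:
  "gram_form G N (\<lambda>i. \<Sum>k\<in>K. r k * c k i) d = (\<Sum>k\<in>K. r k * gram_form G N (c k) d)"
proof -
  have "gram_form G N (\<lambda>i. \<Sum>k\<in>K. r k * c k i) d =
      (\<Sum>i=1..N. \<Sum>j=1..N. \<Sum>k\<in>K. r k * (c k i * d j * G i j))"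
    by (simp add: gram_form_def sum_distrib_right mult.assoc)
  also have "\<dots> = (\<Sum>i=1..N. \<Sum>k\<in>K. \<Sum>j=1..N. r k * (c k i * d j * G i j))"
    by (intro sum.cong refl sum.swap)
  also have "\<dots> = (\<Sum>k\<in>K. \<Sum>i=1..N. \<Sum>j=1..N. r k * (c k i * d j * G i j))"
    by (rule sum.swap)
  finally show ?thesis
    by (simp add: gram_form_def sum_distrib_left)
qed

lemma gram_form_unit_right:
  assumes "s \<in> {1..N}"
  shows "gram_form G N c (\<lambda>j. of_bool (j = s)) = (\<Sum>i=1..N. c i * G i s)"
proof -
  have "(\<Sum>j=1..N. c i * of_bool (j = s) * G i j) = c i * G i s" for i
  proof -
    have "(\<Sum>j=1..N. c i * of_bool (j = s) * G i j) = (\<Sum>j=1..N. if j = s then c i * G i j else 0)"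
      by (intro sum.cong) auto
    then show ?thesis using assms by simp
  qed
  then show ?thesis by (simp add: gram_form_def)
qed

lemma gram_form_unit_unit:
  assumes "s \<in> {1..N}" "t \<in> {1..N}"
  shows "gram_form G N (\<lambda>i. of_bool (i = s)) (\<lambda>j. of_bool (j = t)) = G s t"
proof -
  have "(\<Sum>i=1..N. of_bool (i = s) * G i t) = (\<Sum>i=1..N. if i = s then G i t else 0)"
    by (intro sum.cong) auto
  then show ?thesis using assms by (simp add: gram_form_unit_right)
qed

lemma innov_coeff_support:
  "i \<notin> {1..m + 1} \<Longrightarrow> innov_coeff G m i = 0"
proof (induction m rule: less_induct)
  case (less m)
  have "innov_coeff G k i = 0" if "k < m" for k
    using less that by auto
  then show ?case
    using less.prems by (subst innov_coeff.simps) auto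
qed

lemma innov_coeff_diagonal: "innov_coeff G m (m + 1) = 1"
  by (subst innov_coeff.simps) (simp add: innov_coeff_support)

lemma innov_coeff_eq:
  "innov_coeff G m =
     (\<lambda>i. of_bool (i = m + 1) - (\<Sum>k<m. innov_theta G m (m - k) * innov_coeff G k i))"
  by (rule ext, rule innov_coeff.simps)

lemma unit_eq_innov_coeff:
  "of_bool (i = m + 1) = innov_coeff G m i + (\<Sum>k<m. innov_theta G m (m - k) * innov_coeff G k i)"
  by (subst innov_coeff.simps) simp

text \<open>Expanding \<open>e\<^sub>k\<close> turns \<open>\<langle>X\<^sub>m\<^sub>+\<^sub>1, e\<^sub>k\<rangle>\<close> into \<open>G (m + 1) (k + 1)\<close> minus the sum in the recursion
  for \<open>\<theta>\<^sub>m\<^sub>,\<^sub>m\<^sub>-\<^sub>k\<close>. So the recursion defines \<open>\<theta>\<^sub>m\<^sub>,\<^sub>m\<^sub>-\<^sub>k\<close> as the Fourier coefficient of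
  \<open>X\<^sub>m\<^sub>+\<^sub>1\<close> along \<open>e\<^sub>k\<close>.\<close>

lemma gram_form_unit_innov_coeff:
  assumes sym: "\<And>i j. G i j = G j i"
    and N: "m < N" and km: "k < m"
    and nu: "\<And>j. j < m \<Longrightarrow> innov_nu G j \<noteq> 0"
  shows "gram_form G N (\<lambda>i. of_bool (i = m + 1)) (innov_coeff G k) =
         innov_theta G m (m - k) * innov_nu G k"
  using km
proof (induction k rule: less_induct)
  case (less k)
  let ?u = "\<lambda>s i. of_bool (i = s) :: real"
  have "gram_form G N (?u (m + 1)) (innov_coeff G k) = gram_form G N (innov_coeff G k) (?u (m + 1))"
    by (rule gram_form_commute[OF sym])
  also have "\<dots> = gram_form G N (\<lambda>i. ?u (k + 1) i -
      (\<Sum>j<k. innov_theta G k (k - j) * innov_coeff G j i)) (?u (m + 1))"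
    by (subst innov_coeff_eq) simp
  also have "\<dots> = G (k + 1) (m + 1) -
      (\<Sum>j<k. innov_theta G k (k - j) * gram_form G N (innov_coeff G j) (?u (m + 1)))"
    using N less.prems
    by (subst gram_form_diff_left, subst gram_form_sum_left, subst gram_form_unit_unit) auto
  also have "\<dots> = G (m + 1) (k + 1) -
      (\<Sum>j<k. innov_theta G k (k - j) * innov_theta G m (m - j) * innov_nu G j)"
    using less by (simp add: sym[of "k + 1" "m + 1"] gram_form_commute[OF sym, where c = "innov_coeff G _"]
        mult.assoc del: One_nat_def add_Suc_right)
  also have "\<dots> = innov_theta G m (m - k) * innov_nu G k"
    using innov_theta_rec[OF less.prems, of G] nu[OF less.prems] by (simp add: field_simps)
  finally show ?case .
qed

text \<open>\<open>X\<^sub>s\<^sub>+\<^sub>1\<close> is \<open>e\<^sub>s\<close> plus a combination of earlier innovations, so orthogonality to the earlier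
  innovations is orthogonality to the earlier \<open>X\<close>.\<close>

lemma gram_form_innov_coeff_unit:
  assumes sym: "\<And>i j. G i j = G j i"
    and orth: "\<And>k. k < m \<Longrightarrow> gram_form G N (innov_coeff G m) (innov_coeff G k) = 0"
    and s: "s \<le> m"
  shows "gram_form G N (innov_coeff G m) (\<lambda>i. of_bool (i = s + 1)) =
           (if s = m then gram_form G N (innov_coeff G m) (innov_coeff G m) else 0)"
proof -
  have "gram_form G N (innov_coeff G m) (\<lambda>i. of_bool (i = s + 1)) =
      gram_form G N (\<lambda>i. of_bool (i = s + 1)) (innov_coeff G m)"
    by (rule gram_form_commute[OF sym])
  also have "\<dots> = gram_form G N (innov_coeff G s) (innov_coeff G m) +
      (\<Sum>k<s. innov_theta G s (s - k) * gram_form G N (innov_coeff G k) (innov_coeff G m))"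
    unfolding unit_eq_innov_coeff[of _ s G] by (simp add: gram_form_add_left gram_form_sum_left)
  also have "(\<Sum>k<s. innov_theta G s (s - k) * gram_form G N (innov_coeff G k) (innov_coeff G m)) = 0"
    using s orth by (intro sum.neutral) (auto simp: gram_form_commute[OF sym, where d = "innov_coeff G m"])
  finally show ?thesis
    using s orth[of s] by (auto simp: gram_form_commute[OF sym, where c = "innov_coeff G s"])
qed

text \<open>Non-singularity of the leading block with indices from 1 to \<open>m\<close>, stated as triviality of its
  kernel, the form in which it is used.\<close>

definition gram_nonsingular :: "(nat \<Rightarrow> nat \<Rightarrow> real) \<Rightarrow> nat \<Rightarrow> bool" where
  "gram_nonsingular G m \<longleftrightarrow>
     (\<forall>c. (\<forall>s\<in>{1..m}. (\<Sum>i=1..m. c i * G i s) = 0) \<longrightarrow> (\<forall>i\<in>{1..m}. c i = 0))"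

lemma gram_nonsingularD:
  assumes "gram_nonsingular G m" "\<And>s. s \<in> {1..m} \<Longrightarrow> (\<Sum>i=1..m. c i * G i s) = 0" "i \<in> {1..m}"
  shows "c i = 0"
  using assms unfolding gram_nonsingular_def by blast

text \<open>The bound \<open>N > m\<close> only has to leave room for the coefficients of \<open>e\<^sub>m\<close>. It is quantified
  inside the statement because the induction step for \<open>m\<close> needs the earlier innovations at the
  larger bound.\<close>

lemma innov_coeff_orthogonal_system:
  assumes sym: "\<And>i j. G i j = G j i"
    and nonsing: "\<And>m. m \<ge> 1 \<Longrightarrow> gram_nonsingular G m"
  shows "innov_nu G m \<noteq> 0 \<and>
    (\<forall>N>m. gram_form G N (innov_coeff G m) (innov_coeff G m) = innov_nu G m \<and>
           (\<forall>k<m. gram_form G N (innov_coeff G m) (innov_coeff G k) = 0))"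
proof (induction m rule: less_induct)
  case (less m)
  let ?e = "innov_coeff G" and ?u = "\<lambda>s i. of_bool (i = s) :: real"
  have nu: "innov_nu G j \<noteq> 0" if "j < m" for j
    using less that by blast
  have gram: "gram_form G N (?e j) (?e k) = (if j = k then innov_nu G k else 0)"
    if "j < m" "k < m" "m < N" for j k N
  proof (cases j k rule: linorder_cases)
    case less
    then show ?thesis
      using less.IH[of k] that by (simp add: gram_form_commute[OF sym, where c = "?e j"])
  next
    case equal
    then show ?thesis using less.IH[of k] that by simp
  next
    case greater
    then show ?thesis using less.IH[of j] that by simp
  qed
  have orth: "gram_form G N (?e m) (?e k) = 0" if k: "k < m" and N: "m < N" for k N
  proof -
    have "gram_form G N (?e m) (?e k) = gram_form G N (?u (m + 1)) (?e k) -
        (\<Sum>j<m. innov_theta G m (m - j) * gram_form G N (?e j) (?e k))"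
      by (subst innov_coeff_eq) (simp only: gram_form_diff_left gram_form_sum_left)
    also have "(\<Sum>j<m. innov_theta G m (m - j) * gram_form G N (?e j) (?e k)) =
        (\<Sum>j<m. if j = k then innov_theta G m (m - k) * innov_nu G k else 0)"
      using k N by (intro sum.cong) (auto simp: gram)
    also have "gram_form G N (?u (m + 1)) (?e k) = innov_theta G m (m - k) * innov_nu G k"
      by (rule gram_form_unit_innov_coeff[OF sym N k nu])
    finally show ?thesis using k by simp
  qed
  have norm: "gram_form G N (?e m) (?e m) = innov_nu G m" if N: "m < N" for N
  proof -
    have "gram_form G N (?e m) (?e m) = gram_form G N (?e m) (?u (m + 1))"
      using gram_form_innov_coeff_unit[of G m N m, OF sym orth[OF _ N] order_refl] by simp
    also have "\<dots> = gram_form G N (?u (m + 1)) (?u (m + 1)) -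
        (\<Sum>j<m. innov_theta G m (m - j) * gram_form G N (?e j) (?u (m + 1)))"
      by (subst innov_coeff_eq) (simp only: gram_form_diff_left gram_form_sum_left)
    also have "(\<Sum>j<m. innov_theta G m (m - j) * gram_form G N (?e j) (?u (m + 1))) =
        (\<Sum>j<m. (innov_theta G m (m - j))\<^sup>2 * innov_nu G j)"
      using gram_form_unit_innov_coeff[OF sym N _ nu]
      by (intro sum.cong refl)
        (simp add: gram_form_commute[OF sym, where c = "?e _"] power2_eq_square del: One_nat_def add_Suc_right)
    also have "gram_form G N (?u (m + 1)) (?u (m + 1)) = G (m + 1) (m + 1)"
      using N by (intro gram_form_unit_unit) auto
    finally show ?thesis by (subst innov_nu_rec)
  qed
  \<comment> \<open>Otherwise \<open>e\<^sub>m\<close> is orthogonal to itself as well, hence to every \<open>X\<^sub>s\<close> with \<open>s \<le> m + 1\<close>.\<close>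
  have "innov_nu G m \<noteq> 0"
  proof
    assume 0: "innov_nu G m = 0"
    have "(\<Sum>i=1..m + 1. ?e m i * G i s) = 0" if s: "s \<in> {1..m + 1}" for s
    proof -
      have "(\<Sum>i=1..m + 1. ?e m i * G i s) = gram_form G (m + 1) (?e m) (?u s)"
        using s by (rule gram_form_unit_right[symmetric])
      also have "\<dots> = 0"
      proof -
        obtain t where t: "s = t + 1" "t \<le> m"
          using s by (cases s) auto
        have "gram_form G (m + 1) (?e m) (?u (t + 1)) =
            (if t = m then gram_form G (m + 1) (?e m) (?e m) else 0)"
          by (rule gram_form_innov_coeff_unit[OF sym _ t(2)]) (simp add: orth)
        then show ?thesis
          using norm[of "m + 1"] 0 by (simp add: t(1))
      qed
      finally show ?thesis .
    qed
    then have "?e m (m + 1) = 0"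
      by (rule gram_nonsingularD[OF nonsing, of "m + 1", rotated]) simp_all
    then show False
      using innov_coeff_diagonal[of G m] by simp
  qed
  then show ?case using orth norm by blast
qed

lemma gram_nonsingular_of_invertible_mat:
  assumes sym: "\<And>i j. G i j = G j i"
    and inv: "invertible_mat (Matrix.mat m m (\<lambda>(i, j). G (i + 1) (j + 1)))"
  shows "gram_nonsingular G m"
  unfolding gram_nonsingular_def
proof (intro allI impI ballI)
  fix c i
  assume c: "\<forall>s\<in>{1..m}. (\<Sum>i=1..m. c i * G i s) = 0" and i: "i \<in> {1..m}"
  define A where "A = Matrix.mat m m (\<lambda>(i, j). G (i + 1) (j + 1))"
  define v where "v = Matrix.vec m (\<lambda>i. c (i + 1))"
  have A: "A \<in> carrier_mat m m" and v: "v \<in> carrier_vec m"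
    by (simp_all add: A_def v_def)
  obtain B where AB: "A * B = 1\<^sub>m m" and BA: "B * A = 1\<^sub>m (dim_row B)"
    using inv by (auto simp: invertible_mat_def inverts_mat_def A_def)
  have B: "B \<in> carrier_mat m m"
    using arg_cong[OF AB, of dim_col] arg_cong[OF BA, of dim_col] A by auto
  have "A *\<^sub>v v = 0\<^sub>v m"
  proof (rule eq_vecI)
    fix s assume s: "s < dim_vec (0\<^sub>v m :: real vec)"
    have "(A *\<^sub>v v) $ s = (\<Sum>i<m. c (i + 1) * G (i + 1) (s + 1))"
      using s by (simp add: A_def v_def scalar_prod_def sym[of "Suc s"] mult.commute atLeast0LessThan)
    also have "\<dots> = (\<Sum>i=1..m. c i * G i (s + 1))"
      by (rule sum.reindex_bij_witness[of _ "\<lambda>i. i - 1" "\<lambda>i. i + 1"]) auto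
    also have "\<dots> = 0" using c s by auto
    finally show "(A *\<^sub>v v) $ s = 0\<^sub>v m $ s" using s by simp
  qed (simp add: A_def)
  then have "B *\<^sub>v (A *\<^sub>v v) = 0\<^sub>v m"
    using B by auto
  then have "v = 0\<^sub>v m"
    using B BA v by (simp flip: assoc_mult_mat_vec[OF B A v])
  then have "v $ (i - 1) = 0" using i by auto
  then show "c i = 0" using i by (auto simp: v_def)
qed

section \<open>Uniqueness of the coefficients\<close>

definition tl_comb ::
    "(real \<Rightarrow> real) \<Rightarrow> ('i \<Rightarrow> 'a \<Rightarrow> real) \<Rightarrow> 'i set \<Rightarrow> ('i \<Rightarrow> real) \<Rightarrow> 'a \<Rightarrow> real" where
  "tl_comb \<tau> X I c = (\<lambda>\<omega>. \<tau> (\<Sum>i\<in>I. c i * inv_into UNIV \<tau> (X i \<omega>)))"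

context transformed_linear_noise
begin

lemma tau_inv_tau [simp]: "inv_into UNIV \<tau> (\<tau> y) = y"
  using tau_bij by (auto simp: bij_betw_def)

lemma tau_tau_inv: "y > 0 \<Longrightarrow> \<tau> (inv_into UNIV \<tau> y) = y"
  using tau_bij by (intro f_inv_into_f) (auto simp: bij_betw_def)

lemma Z_measurable [measurable]: "Z j \<in> borel_measurable M"
  using Z_indep unfolding indep_vars_def by auto

declare tau_measurable [measurable] tau_inv_measurable [measurable]

text \<open>An almost sure identity \<open>\<tau>\<^sup>-\<^sup>1(Z\<^sub>k) = S\<close> with \<open>S\<close> independent of \<open>Z\<^sub>k\<close> gives
  \<open>Pr(A) = Pr(A)\<^sup>2\<close> for the events \<open>A\<close> in the far tail of \<open>Z\<^sub>k\<close>, a zero-one law that regular variation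
  excludes.\<close>

lemma noise_not_determined_independently:
  assumes ind: "indep_var borel (Z k) borel S"
    and eq: "AE \<omega> in M. inv_into UNIV \<tau> (Z k \<omega>) = S \<omega>"
  shows False
proof -
  obtain c where c: "c > 0"
    and lim: "((\<lambda>s. s * prob {\<omega> \<in> space M. Z k \<omega> > b s}) \<longlongrightarrow> c) at_top"
    and b: "filterlim b at_top at_top"
    using Z_regularly_varying[of k] unfolding regularly_varying_rv_def
    by (auto dest: spec[of _ 1])
  have [measurable]: "S \<in> borel_measurable M"
    using ind by (auto dest: indep_var_rv2)
  \<comment> \<open>The value 0 of \<open>Z k\<close> is outside the range of \<open>\<tau>\<close>, where the inverse takes a default value. Above
    \<open>\<tau>\<close> of that default, the tail event is still an event about \<open>\<tau>\<^sup>-\<^sup>1(Z\<^sub>k)\<close>.\<close>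
  have zero_one: "prob {\<omega> \<in> space M. Z k \<omega> > x} \<in> {0, 1}"
    if x: "x \<ge> 0" "x \<ge> \<tau> (inv_into UNIV \<tau> 0)" for x
  proof -
    let ?A = "{\<omega> \<in> space M. Z k \<omega> > x}" and ?B = "{\<omega> \<in> space M. \<tau> (S \<omega>) > x}"
    have iff: "Z k \<omega> > x \<longleftrightarrow> \<tau> (inv_into UNIV \<tau> (Z k \<omega>)) > x" if "\<omega> \<in> space M" for \<omega>
      using x Z_nonneg[OF that, of k] tau_tau_inv[of "Z k \<omega>"] by (cases "Z k \<omega> = 0") auto
    have AB: "AE \<omega> in M. \<omega> \<in> ?A \<longleftrightarrow> \<omega> \<in> ?B"
      using eq AE_space by eventually_elim (use iff in auto)
    have "prob (?A \<inter> ?B) = prob ?A * prob ?B"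
    proof -
      have T: "{y. \<tau> y > x} \<in> sets borel"
        using measurable_sets[OF tau_measurable, of "{x<..}"] by (simp add: vimage_def)
      have "(\<lambda>\<omega>. (Z k \<omega>, S \<omega>)) -` ({x<..} \<times> {y. \<tau> y > x}) \<inter> space M = ?A \<inter> ?B"
        "Z k -` {x<..} \<inter> space M = ?A" "S -` {y. \<tau> y > x} \<inter> space M = ?B"
        by auto
      then show ?thesis
        using indep_varD[OF ind, of "{x<..}" "{y. \<tau> y > x}"] T by simp
    qed
    moreover have "prob ?B = prob ?A" "prob (?A \<inter> ?B) = prob ?A"
      using AB by (auto intro!: finite_measure_eq_AE)
    ultimately show ?thesis by auto
  qed
  \<comment> \<open>A number \<open>s * p\<close> with \<open>p \<in> {0, 1}\<close> cannot lie strictly between 0 and \<open>c + 1\<close> once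
    \<open>s > c + 1\<close>.\<close>
  have "\<forall>\<^sub>F s in at_top. b s \<ge> max 0 (\<tau> (inv_into UNIV \<tau> 0))"
    using b unfolding filterlim_at_top by blast
  moreover have "\<forall>\<^sub>F s in at_top. s * prob {\<omega> \<in> space M. Z k \<omega> > b s} > 0"
    using order_tendstoD(1)[OF lim c] .
  moreover have "\<forall>\<^sub>F s in at_top. s * prob {\<omega> \<in> space M. Z k \<omega> > b s} < c + 1"
    using order_tendstoD(2)[OF lim, of "c + 1"] by simp
  moreover have "\<forall>\<^sub>F s in at_top. s > c + 1"
    by (rule eventually_gt_at_top)
  ultimately have "\<forall>\<^sub>F s::real in at_top. False"
  proof eventually_elim
    case (elim s)
    then show False using zero_one[of "b s"] by auto
  qed
  then show False by simp
qed

text \<open>If \<open>d\<^sub>k \<noteq> 0\<close>, the relation can be solved for \<open>\<tau>\<^sup>-\<^sup>1(Z\<^sub>k)\<close>, which makes it a measurable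
  function \<open>g\<close> of the noise variables other than \<open>Z\<^sub>k\<close>.\<close>

lemma noise_series_zero_imp_coeff_zero:
  assumes zero: "AE \<omega> in M. (\<lambda>j. d j * inv_into UNIV \<tau> (Z j \<omega>)) sums 0"
  shows "d k = 0"
proof (rule ccontr)
  assume k: "d k \<noteq> 0"
  define g where "g f = (\<Sum>j. if j = k then 0 else - d j / d k * inv_into UNIV \<tau> (f j))"
    for f :: "nat \<Rightarrow> real"
  define S where "S = (\<lambda>\<omega>. g (restrict (\<lambda>j. Z j \<omega>) (- {k})))"
  have term_measurable: "(\<lambda>f. if j = k then 0 else - d j / d k * inv_into UNIV \<tau> (f j))
      \<in> borel_measurable (PiM (- {k}) (\<lambda>_. borel))" for j
  proof (cases "j = k")
    case False
    then have [measurable]: "(\<lambda>f. f j) \<in> measurable (PiM (- {k}) (\<lambda>_. borel)) (borel :: real measure)"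
      by (intro measurable_component_singleton) auto
    show ?thesis using False by simp
  qed simp
  have g: "g \<in> borel_measurable (PiM (- {k}) (\<lambda>_. borel))"
    unfolding g_def by (intro borel_measurable_suminf term_measurable)
  have "indep_var borel ((\<lambda>f. f k) \<circ> (\<lambda>\<omega>. restrict (\<lambda>j. Z j \<omega>) {k})) borel
      (g \<circ> (\<lambda>\<omega>. restrict (\<lambda>j. Z j \<omega>) (- {k})))"
    by (intro indep_var_compose[OF indep_var_restrict[OF Z_indep]] g) auto
  then have "indep_var borel (Z k) borel S"
    by (simp add: S_def comp_def)
  moreover have "AE \<omega> in M. inv_into UNIV \<tau> (Z k \<omega>) = S \<omega>"
    using zero
  proof eventually_elim
    case (elim \<omega>)
    let ?w = "\<lambda>j. inv_into UNIV \<tau> (Z j \<omega>)"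
    have "(\<lambda>j. - d j / d k * ?w j) sums 0"
      using sums_mult[OF elim, of "- 1 / d k"] by (simp add: mult.assoc)
    from sums_add[OF this sums_single[of k "\<lambda>_. ?w k"]]
    have "(\<lambda>j. - d j / d k * ?w j + (if j = k then ?w k else 0)) sums ?w k" by simp
    also have "(\<lambda>j. - d j / d k * ?w j + (if j = k then ?w k else 0)) =
        (\<lambda>j. if j = k then 0 else - d j / d k * inv_into UNIV \<tau> (restrict (\<lambda>j. Z j \<omega>) (- {k}) j))"
      using k by auto
    finally show ?case
      by (simp add: S_def g_def sums_iff)
  qed
  ultimately show False
    by (rule noise_not_determined_independently)
qed

lemma has_tl_coeffs_unique:
  assumes "has_tl_coeffs M \<tau> Z X \<phi>" "has_tl_coeffs M \<tau> Z X \<psi>"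
  shows "\<phi> = \<psi>"
proof
  fix k
  have "AE \<omega> in M. (\<lambda>j. (\<phi> j - \<psi> j) * inv_into UNIV \<tau> (Z j \<omega>)) sums 0"
    using assms[unfolded has_tl_coeffs_def, THEN conjunct2, THEN conjunct2]
  proof eventually_elim
    case (elim \<omega>)
    then have "(\<Sum>j. \<phi> j * inv_into UNIV \<tau> (Z j \<omega>)) = (\<Sum>j. \<psi> j * inv_into UNIV \<tau> (Z j \<omega>))"
      by (metis tau_inv_tau)
    then show ?case
      using elim sums_diff[OF summable_sums summable_sums] by (fastforce simp: left_diff_distrib)
  qed
  then show "\<phi> k = \<psi> k"
    using noise_series_zero_imp_coeff_zero[of "\<lambda>j. \<phi> j - \<psi> j" k] by linarith
qed

lemma tl_coeffs_eq: "has_tl_coeffs M \<tau> Z X \<psi> \<Longrightarrow> tl_coeffs M \<tau> Z X = \<psi>"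
  unfolding tl_coeffs_def by (rule the_equality, assumption, rule has_tl_coeffs_unique)

lemma has_tl_coeffs_tl_coeffs:
  assumes "X \<in> tl_space M \<tau> Z"
  shows "has_tl_coeffs M \<tau> Z X (tl_coeffs M \<tau> Z X)"
proof -
  obtain \<psi> where "has_tl_coeffs M \<tau> Z X \<psi>"
    using assms by (auto simp: tl_space_def)
  then show ?thesis by (simp only: tl_coeffs_eq)
qed

section \<open>Bilinearity of the inner product\<close>

lemma has_tl_coeffs_tl_comb:
  assumes I: "finite I" and X: "\<And>i. i \<in> I \<Longrightarrow> has_tl_coeffs M \<tau> Z (X i) (\<phi> i)"
  shows "has_tl_coeffs M \<tau> Z (tl_comb \<tau> X I c) (\<lambda>j. \<Sum>i\<in>I. c i * \<phi> i j)"
  unfolding has_tl_coeffs_def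
proof (intro conjI)
  have "(\<lambda>\<omega>. \<Sum>i\<in>I. c i * inv_into UNIV \<tau> (X i \<omega>)) \<in> borel_measurable M"
  proof (rule borel_measurable_sum)
    fix i assume "i \<in> I"
    then have [measurable]: "X i \<in> borel_measurable M"
      using X by (auto simp: has_tl_coeffs_def)
    show "(\<lambda>\<omega>. c i * inv_into UNIV \<tau> (X i \<omega>)) \<in> borel_measurable M"
      by measurable
  qed
  then show "tl_comb \<tau> X I c \<in> borel_measurable M"
    unfolding tl_comb_def by measurable
next
  show "summable (\<lambda>j. \<bar>\<Sum>i\<in>I. c i * \<phi> i j\<bar>)"
  proof (rule summable_comparison_test')
    show "summable (\<lambda>j. \<Sum>i\<in>I. \<bar>c i\<bar> * \<bar>\<phi> i j\<bar>)"
      using X by (intro summable_sum summable_mult) (auto simp: has_tl_coeffs_def)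
    show "norm \<bar>\<Sum>i\<in>I. c i * \<phi> i j\<bar> \<le> (\<Sum>i\<in>I. \<bar>c i\<bar> * \<bar>\<phi> i j\<bar>)" if "j \<ge> 0" for j
      using sum_abs[of "\<lambda>i. c i * \<phi> i j" I] by (simp add: abs_mult)
  qed
next
  have "AE \<omega> in M. \<forall>i\<in>I. summable (\<lambda>j. \<phi> i j * inv_into UNIV \<tau> (Z j \<omega>)) \<and>
      X i \<omega> = \<tau> (\<Sum>j. \<phi> i j * inv_into UNIV \<tau> (Z j \<omega>))"
    using X I by (intro AE_finite_allI) (auto simp: has_tl_coeffs_def)
  then show "AE \<omega> in M. summable (\<lambda>j. (\<Sum>i\<in>I. c i * \<phi> i j) * inv_into UNIV \<tau> (Z j \<omega>)) \<and>
      tl_comb \<tau> X I c \<omega> = \<tau> (\<Sum>j. (\<Sum>i\<in>I. c i * \<phi> i j) * inv_into UNIV \<tau> (Z j \<omega>))"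
  proof eventually_elim
    case (elim \<omega>)
    have "(\<lambda>j. \<phi> i j * inv_into UNIV \<tau> (Z j \<omega>)) sums inv_into UNIV \<tau> (X i \<omega>)" if "i \<in> I" for i
      using elim that by (auto simp: sums_iff)
    then have "(\<lambda>j. \<Sum>i\<in>I. c i * (\<phi> i j * inv_into UNIV \<tau> (Z j \<omega>))) sums
        (\<Sum>i\<in>I. c i * inv_into UNIV \<tau> (X i \<omega>))"
      by (intro sums_sum sums_mult)
    then show ?case
      by (simp add: tl_comb_def sum_distrib_right mult.assoc sums_iff)
  qed
qed

lemma tl_comb_in_tl_space:
  "finite I \<Longrightarrow> (\<And>i. i \<in> I \<Longrightarrow> X i \<in> tl_space M \<tau> Z) \<Longrightarrow> tl_comb \<tau> X I c \<in> tl_space M \<tau> Z"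
  using has_tl_coeffs_tl_comb[OF _ has_tl_coeffs_tl_coeffs, of I X c] unfolding tl_space_def by blast

lemma summable_tl_inner:
  assumes "X \<in> tl_space M \<tau> Z" "Y \<in> tl_space M \<tau> Z"
  shows "summable (\<lambda>j. tl_coeffs M \<tau> Z X j * tl_coeffs M \<tau> Z Y j)"
proof -
  have X: "summable (\<lambda>j. \<bar>tl_coeffs M \<tau> Z X j\<bar>)" and Y: "summable (\<lambda>j. \<bar>tl_coeffs M \<tau> Z Y j\<bar>)"
    using assms[THEN has_tl_coeffs_tl_coeffs] by (auto simp: has_tl_coeffs_def)
  have "\<forall>\<^sub>F j in sequentially. \<bar>tl_coeffs M \<tau> Z Y j\<bar> < 1"
    using order_tendstoD(2)[OF summable_LIMSEQ_zero[OF Y], of 1] by simp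
  then have "\<forall>\<^sub>F j in sequentially.
      norm (tl_coeffs M \<tau> Z X j * tl_coeffs M \<tau> Z Y j) \<le> \<bar>tl_coeffs M \<tau> Z X j\<bar>"
    by eventually_elim (auto simp: abs_mult intro: mult_left_le)
  then show ?thesis
    using X by (rule summable_comparison_test_ev)
qed

lemma tl_inner_commute: "tl_inner M \<tau> Z X Y = tl_inner M \<tau> Z Y X"
  by (simp add: tl_inner_def mult.commute)

lemma tl_inner_tl_comb_left:
  assumes I: "finite I" and X: "\<And>i. i \<in> I \<Longrightarrow> X i \<in> tl_space M \<tau> Z" and Y: "Y \<in> tl_space M \<tau> Z"
  shows "tl_inner M \<tau> Z (tl_comb \<tau> X I c) Y = (\<Sum>i\<in>I. c i * tl_inner M \<tau> Z (X i) Y)"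
proof -
  let ?\<phi> = "\<lambda>i. tl_coeffs M \<tau> Z (X i)"
  have "tl_coeffs M \<tau> Z (tl_comb \<tau> X I c) = (\<lambda>j. \<Sum>i\<in>I. c i * ?\<phi> i j)"
    by (intro tl_coeffs_eq has_tl_coeffs_tl_comb has_tl_coeffs_tl_coeffs I X)
  moreover have "(\<lambda>j. \<Sum>i\<in>I. c i * (?\<phi> i j * tl_coeffs M \<tau> Z Y j)) sums
      (\<Sum>i\<in>I. c i * tl_inner M \<tau> Z (X i) Y)"
    unfolding tl_inner_def by (intro sums_sum sums_mult summable_sums summable_tl_inner X Y)
  ultimately show ?thesis
    by (simp add: tl_inner_def[of M \<tau> Z "tl_comb \<tau> X I c"] sum_distrib_right mult.assoc sums_iff)
qed

lemma tl_inner_tl_comb: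
  assumes X: "\<And>i. i \<in> {1..N} \<Longrightarrow> X i \<in> tl_space M \<tau> Z"
  shows "tl_inner M \<tau> Z (tl_comb \<tau> X {1..N} c) (tl_comb \<tau> X {1..N} d) =
    gram_form (\<lambda>i j. tl_inner M \<tau> Z (X i) (X j)) N c d"
proof -
  have "tl_inner M \<tau> Z (tl_comb \<tau> X {1..N} c) (tl_comb \<tau> X {1..N} d) =
      (\<Sum>i=1..N. c i * tl_inner M \<tau> Z (X i) (tl_comb \<tau> X {1..N} d))"
    by (intro tl_inner_tl_comb_left tl_comb_in_tl_space X) auto
  also have "\<dots> = (\<Sum>i=1..N. c i * (\<Sum>j=1..N. d j * tl_inner M \<tau> Z (X i) (X j)))"
  proof (intro sum.cong refl arg_cong2[of _ _ _ _ "(*)"])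
    fix i assume i: "i \<in> {1..N}"
    show "tl_inner M \<tau> Z (X i) (tl_comb \<tau> X {1..N} d) = (\<Sum>j=1..N. d j * tl_inner M \<tau> Z (X i) (X j))"
      unfolding tl_inner_commute[of "X i"] using i by (intro tl_inner_tl_comb_left X) auto
  qed
  finally show ?thesis
    by (simp add: gram_form_def sum_distrib_left mult.assoc)
qed

lemma tl_inner_self_nonneg: "X \<in> tl_space M \<tau> Z \<Longrightarrow> tl_inner M \<tau> Z X X \<ge> 0"
  unfolding tl_inner_def by (intro suminf_nonneg summable_tl_inner) auto

section \<open>The predictors\<close>

lemma past_span_eq: "past_span \<tau> X n = range (tl_comb \<tau> X {1..n})"
proof -
  have *: "tl_sum \<tau> (\<lambda>j. tl_scale \<tau> (\<beta> j) (X (n + 1 - j))) {1..n} =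
      tl_comb \<tau> X {1..n} (\<lambda>i. \<beta> (n + 1 - i))" for \<beta>
  proof -
    have "(\<Sum>j=1..n. \<beta> j * inv_into UNIV \<tau> (X (n + 1 - j) \<omega>)) =
        (\<Sum>i=1..n. \<beta> (n + 1 - i) * inv_into UNIV \<tau> (X i \<omega>))" for \<omega>
      by (rule sum.reindex_bij_witness[of _ "\<lambda>i. n + 1 - i" "\<lambda>i. n + 1 - i"]) auto
    then show ?thesis
      by (simp add: tl_sum_def tl_scale_def tl_comb_def del: One_nat_def)
  qed
  show ?thesis
  proof (intro equalityI subsetI)
    fix Y assume "Y \<in> past_span \<tau> X n"
    then show "Y \<in> range (tl_comb \<tau> X {1..n})"
      unfolding past_span_def * by blast
  next
    fix Y assume "Y \<in> range (tl_comb \<tau> X {1..n})"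
    then obtain c where "Y = tl_comb \<tau> X {1..n} c" by blast
    also have "\<dots> = tl_comb \<tau> X {1..n} (\<lambda>i. c (n + 1 - (n + 1 - i)))"
      unfolding tl_comb_def by (intro ext arg_cong[of _ _ \<tau>] sum.cong) auto
    finally show "Y \<in> past_span \<tau> X n"
      unfolding past_span_def * by (auto intro!: exI[of _ "\<lambda>j. c (n + 1 - j)"])
  qed
qed

lemma tl_diff_tl_comb:
  fixes m :: nat
  shows "tl_diff \<tau> (X (m + 1)) (tl_comb \<tau> X {1..m} h) =
   tl_comb \<tau> X {1..m + 1} (\<lambda>i. if i = m + 1 then 1 else - h i)"
proof
  fix \<omega>
  have "(\<Sum>i=1..m. (if i = m + 1 then 1 else - h i) * inv_into UNIV \<tau> (X i \<omega>)) =
      (\<Sum>i=1..m. - h i * inv_into UNIV \<tau> (X i \<omega>))"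
    by (intro sum.cong) auto
  then show "tl_diff \<tau> (X (m + 1)) (tl_comb \<tau> X {1..m} h) \<omega> =
      tl_comb \<tau> X {1..m + 1} (\<lambda>i. if i = m + 1 then 1 else - h i) \<omega>"
    by (simp add: tl_diff_def tl_add_def tl_scale_def tl_comb_def sum_negf)
qed

lemma tl_diff_innov_predictor:
  "tl_diff \<tau> (X (m + 1)) (tl_comb \<tau> X {1..m} (innov_predictor_coeff G m)) =
   tl_comb \<tau> X {1..m + 1} (innov_coeff G m)"
proof -
  have "(if i = m + 1 then 1 else - innov_predictor_coeff G m i) = innov_coeff G m i" for i
  proof (cases "i = m + 1")
    case True
    then show ?thesis using innov_coeff_diagonal[of G m] by simp
  next
    case False
    then show ?thesis using innov_coeff_eq[of G m] by (simp add: innov_predictor_coeff_def)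
  qed
  then show ?thesis by (simp only: tl_diff_tl_comb)
qed

text \<open>By this formula, orthogonality of the prediction error to \<open>X\<^sub>s\<close> is the \<open>s\<close>-th normal equation for the
  coefficients \<open>h\<close> of the prediction.\<close>

lemma tl_inner_prediction_error:
  fixes m :: nat
  assumes X: "\<And>t. t \<ge> 1 \<Longrightarrow> X t \<in> tl_space M \<tau> Z" and s: "s \<ge> 1"
  shows "tl_inner M \<tau> Z (tl_diff \<tau> (X (m + 1)) (tl_comb \<tau> X {1..m} h)) (X s) =
    tl_inner M \<tau> Z (X (m + 1)) (X s) - (\<Sum>i=1..m. h i * tl_inner M \<tau> Z (X i) (X s))"
proof -
  have "(\<Sum>i=1..m. (if i = m + 1 then 1 else - h i) * tl_inner M \<tau> Z (X i) (X s)) =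
      (\<Sum>i=1..m. - h i * tl_inner M \<tau> Z (X i) (X s))"
    by (intro sum.cong) auto
  then show ?thesis
    using X s by (subst tl_diff_tl_comb, subst tl_inner_tl_comb_left) (simp_all add: sum_negf)
qed

text \<open>Two solutions of the normal equations differ by a vector in the kernel of the Gram matrix, so
  the coefficients of the predictor are unique. Hence there is only one candidate even up to
  pointwise equality, as the definite description in the definition of the predictor requires.\<close>

lemma one_step_predictor_eq_innov_predictor:
  fixes X :: "nat \<Rightarrow> 'a \<Rightarrow> real"
  defines "G \<equiv> \<lambda>i j. tl_inner M \<tau> Z (X i) (X j)"
  assumes X: "\<And>t. t \<ge> 1 \<Longrightarrow> X t \<in> tl_space M \<tau> Z"
    and nonsing: "\<And>m. m \<ge> 1 \<Longrightarrow> gram_nonsingular G m"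
  shows "one_step_predictor M \<tau> Z X (m + 1) =
    tl_comb \<tau> X {1..m} (innov_predictor_coeff G m)"
proof (cases "m = 0")
  case True
  then show ?thesis by (simp add: one_step_predictor_def tl_zero_def tl_comb_def)
next
  case False
  let ?h = "innov_predictor_coeff G m"
  let ?err = "\<lambda>Y. tl_diff \<tau> (X (m + 1)) Y"
  have sym: "G i j = G j i" for i j
    by (simp add: G_def tl_inner_commute)
  have orth: "tl_inner M \<tau> Z (?err (tl_comb \<tau> X {1..m} ?h)) (X s) = 0" if s: "s \<in> {1..m}" for s
  proof -
    have "tl_inner M \<tau> Z (?err (tl_comb \<tau> X {1..m} ?h)) (X s) =
        (\<Sum>i=1..m + 1. innov_coeff G m i * G i s)"
      using X s by (subst tl_diff_innov_predictor, subst tl_inner_tl_comb_left) (auto simp: G_def)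
    also have "\<dots> = gram_form G (m + 1) (innov_coeff G m) (\<lambda>i. of_bool (i = s))"
      using s by (intro gram_form_unit_right[symmetric]) auto
    also have "\<dots> = 0"
    proof -
      obtain t where t: "s = t + 1" "t < m"
        using s by (cases s) auto
      show ?thesis
        using gram_form_innov_coeff_unit[of G m "m + 1" t, OF sym] t
          innov_coeff_orthogonal_system[of G m, OF sym nonsing] by simp
    qed
    finally show ?thesis .
  qed
  have "(THE Y. Y \<in> past_span \<tau> X m \<and>
      (\<forall>k\<in>{1..m}. tl_inner M \<tau> Z (?err Y) (X (m + 1 - k)) = 0)) = tl_comb \<tau> X {1..m} ?h"
  proof (rule the_equality)
    show "tl_comb \<tau> X {1..m} ?h \<in> past_span \<tau> X m \<and>
        (\<forall>k\<in>{1..m}. tl_inner M \<tau> Z (?err (tl_comb \<tau> X {1..m} ?h)) (X (m + 1 - k)) = 0)"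
      unfolding past_span_eq by (auto intro!: orth simp del: One_nat_def)
  next
    fix Y
    assume Y: "Y \<in> past_span \<tau> X m \<and>
        (\<forall>k\<in>{1..m}. tl_inner M \<tau> Z (?err Y) (X (m + 1 - k)) = 0)"
    then obtain h where h: "Y = tl_comb \<tau> X {1..m} h"
      unfolding past_span_eq by blast
    have "(\<Sum>i=1..m. (h i - ?h i) * G i s) = 0" if s: "s \<in> {1..m}" for s
    proof -
      have "tl_inner M \<tau> Z (?err Y) (X s) = 0"
        using Y[THEN conjunct2, THEN bspec, of "m + 1 - s"] s by (auto simp: Suc_leI Suc_diff_le)
      then show ?thesis
        using orth[OF s] s unfolding h
        by (subst (asm) (1 2) tl_inner_prediction_error[OF X])
          (auto simp: G_def left_diff_distrib sum_subtractf)
    qed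
    then have "h i - ?h i = 0" if "i \<in> {1..m}" for i
      using gram_nonsingularD[OF nonsing, of m "\<lambda>i. h i - ?h i"] False that by simp
    then show "Y = tl_comb \<tau> X {1..m} ?h"
      unfolding h tl_comb_def by (intro ext arg_cong[of _ _ \<tau>] sum.cong) simp_all
  qed
  then show ?thesis using False by (simp add: one_step_predictor_def)
qed

lemma tl_comb_innov_predictor:
  "tl_comb \<tau> X {1..n} (innov_predictor_coeff G n) =
   tl_sum \<tau> (\<lambda>j. tl_scale \<tau> (innov_theta G n j)
     (tl_comb \<tau> X {1..n - j + 1} (innov_coeff G (n - j)))) {1..n}"
proof
  fix \<omega>
  let ?x = "\<lambda>i. inv_into UNIV \<tau> (X i \<omega>)"
  have "(\<Sum>i=1..n. innov_predictor_coeff G n i * ?x i) =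
      (\<Sum>i=1..n. \<Sum>k<n. innov_theta G n (n - k) * (innov_coeff G k i * ?x i))"
    by (simp add: innov_predictor_coeff_def sum_distrib_right mult.assoc)
  also have "\<dots> = (\<Sum>k<n. innov_theta G n (n - k) * (\<Sum>i=1..n. innov_coeff G k i * ?x i))"
    by (subst sum.swap) (simp add: sum_distrib_left)
  also have "\<dots> = (\<Sum>k<n. innov_theta G n (n - k) * (\<Sum>i=1..k + 1. innov_coeff G k i * ?x i))"
    by (intro sum.cong refl arg_cong2[of _ _ _ _ "(*)"] sum.mono_neutral_right)
      (auto intro!: innov_coeff_support)
  also have "\<dots> = (\<Sum>j=1..n. innov_theta G n j *
      (\<Sum>i=1..n - j + 1. innov_coeff G (n - j) i * ?x i))"
    by (rule sum.reindex_bij_witness[of _ "\<lambda>j. n - j" "\<lambda>k. n - k"]) auto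
  finally show "tl_comb \<tau> X {1..n} (innov_predictor_coeff G n) \<omega> =
      tl_sum \<tau> (\<lambda>j. tl_scale \<tau> (innov_theta G n j)
        (tl_comb \<tau> X {1..n - j + 1} (innov_coeff G (n - j)))) {1..n} \<omega>"
    by (simp add: tl_comb_def tl_sum_def tl_scale_def)
qed

end

theorem proposition1:
  fixes M :: "'a measure" and \<tau> :: "real \<Rightarrow> real" and Z :: "nat \<Rightarrow> 'a \<Rightarrow> real"
    and L b :: "real \<Rightarrow> real" and X :: "nat \<Rightarrow> 'a \<Rightarrow> real" and n :: nat
  defines "G \<equiv> \<lambda>i j. tl_inner M \<tau> Z (X i) (X j)"
    and "Xhat \<equiv> one_step_predictor M \<tau> Z X"
  assumes "transformed_linear_noise M \<tau> Z L b"
    and "\<And>t. t \<ge> 1 \<Longrightarrow> X t \<in> tl_space M \<tau> Z"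
    and "\<And>m. m \<ge> 1 \<Longrightarrow> invertible_mat (gram_matrix M \<tau> Z X m)"
  shows "Xhat (n + 1) =
           (if n = 0 then tl_zero \<tau>
            else tl_sum \<tau> (\<lambda>j. tl_scale \<tau> (innov_theta G n j)
                               (tl_diff \<tau> (X (n + 1 - j)) (Xhat (n + 1 - j)))) {1..n})
         \<and> innov_nu G n \<noteq> 0
         \<and> innov_nu G n = (tl_norm M \<tau> Z (tl_diff \<tau> (X (n + 1)) (Xhat (n + 1))))\<^sup>2"
proof -
  interpret transformed_linear_noise M \<tau> Z L b by fact
  note X = assms(4)
  have sym: "G i j = G j i" for i j
    by (simp add: G_def tl_inner_commute)
  have nonsing: "gram_nonsingular G m" if "m \<ge> 1" for m
    using assms(5)[OF that]
    by (intro gram_nonsingular_of_invertible_mat[OF sym]) (simp add: gram_matrix_def G_def)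
  have Xhat: "Xhat (m + 1) = tl_comb \<tau> X {1..m} (innov_predictor_coeff G m)" for m
    using one_step_predictor_eq_innov_predictor[of X m] X nonsing by (simp add: Xhat_def G_def)
  have innovation: "tl_diff \<tau> (X (m + 1)) (Xhat (m + 1)) = tl_comb \<tau> X {1..m + 1} (innov_coeff G m)" for m
    unfolding Xhat by (rule tl_diff_innov_predictor)
  have system: "innov_nu G n \<noteq> 0"
    "gram_form G (n + 1) (innov_coeff G n) (innov_coeff G n) = innov_nu G n"
    using innov_coeff_orthogonal_system[of G n, OF sym nonsing] by auto
  have "Xhat (n + 1) = tl_zero \<tau>" if "n = 0"
    using that by (simp add: Xhat_def one_step_predictor_def)
  moreover have "Xhat (n + 1) = tl_sum \<tau> (\<lambda>j. tl_scale \<tau> (innov_theta G n j)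
      (tl_diff \<tau> (X (n + 1 - j)) (Xhat (n + 1 - j)))) {1..n}"
  proof -
    have "tl_diff \<tau> (X (n + 1 - j)) (Xhat (n + 1 - j)) =
        tl_comb \<tau> X {1..n - j + 1} (innov_coeff G (n - j))" if "j \<in> {1..n}" for j
      using innovation[of "n - j"] that by (simp add: Suc_diff_le)
    then show ?thesis
      unfolding Xhat[of n] tl_comb_innov_predictor by (auto simp: tl_sum_def tl_scale_def)
  qed
  moreover have "innov_nu G n = (tl_norm M \<tau> Z (tl_diff \<tau> (X (n + 1)) (Xhat (n + 1))))\<^sup>2"
  proof -
    have "tl_comb \<tau> X {1..n + 1} (innov_coeff G n) \<in> tl_space M \<tau> Z"
      by (intro tl_comb_in_tl_space X) auto
    then have "(tl_norm M \<tau> Z (tl_diff \<tau> (X (n + 1)) (Xhat (n + 1))))\<^sup>2 =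
        tl_inner M \<tau> Z (tl_comb \<tau> X {1..n + 1} (innov_coeff G n))
          (tl_comb \<tau> X {1..n + 1} (innov_coeff G n))"
      unfolding innovation tl_norm_def by (intro real_sqrt_pow2 tl_inner_self_nonneg)
    also have "\<dots> = innov_nu G n"
      using tl_inner_tl_comb[of "n + 1" X] X system(2) by (simp add: G_def)
    finally show ?thesis by simp
  qed
  ultimately show ?thesis using system(1) by presburger
qed

end
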